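(* Let $n_1,n_2$ be distinct odd primes with $\gcd(n_1-1,n_2-1)=6$, $n=n_1n_2$, $e=(n_1-1)(n_2-1)/6$. Let $g$ be a common primitive root of $n_1$ and $n_2$, let $u$ be an integer with $u\equiv g \pmod{n_1}$ and $u\equiv 1\pmod{n_2}$, and for $i=0,\dots,5$ let $D_i=\{g^s u^i \bmod n : s=0,1,\dots,e-1\}$. Let $q$ be a power of a prime $p$ with $\gcd(q,n)=1$, and suppose $q \bmod n \in D_1\cup D_3\cup D_5$. Let $\boldsymbol{C_s}$ be the cyclic code of length $n$ over $\mathrm{GF}(q)$ defined by the Whiteman generalized cyclotomic sequence of order 6 (see context), with generator polynomial $g_s(x)=\frac{x^n-1}{\gcd(x^n-1,S(x))}$. Let $\Omega_1=\frac{n_1+1}{2} \bmod p$, $\Omega_2=\frac{n_2-1}{2}\bmod p$, $\Omega=\frac{(n_1+1)(n_2-1)}{2}\bmod p$, and $d(x)=\prod_{i\in \mathbb{Z}_n^*}(x-\beta^i)$. Then $$g_s(x)=\begin{cases} x^n-1, & \Omega_1\neq 0,\ \Omega_2\neq 0,\ \Omega\neq 0,\\ \frac{x^n-1}{x-1}, & \Omega_1\neq 0,\ \Omega_2\neq 0,\ \Omega=0,\\ \frac{x^n-1}{x^{n_2}-1}, & \Omega_1=0,\ \Omega_2\neq 0,\ \Omega=0,\\ \frac{x^n-1}{x^{n_1}-1}, & \Omega_1\neq 0,\ \Omega_2=0,\ \Omega=0,\\ d(x), & \Omega_1=\Omega_2=\Omega=0.\end{cases}$$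
   Context: The sets $D_0,\dots,D_5$ (Whiteman generalized cyclotomic classes of order 6) partition $\mathbb{Z}_n^*$. Let $m$ be the multiplicative order of $q$ modulo $n$, $\alpha$ a primitive element of $\mathrm{GF}(q^m)$ and $\beta=\alpha^{(q^m-1)/n}$, a primitive $n$-th root of unity. Let $N_1=\{n_1,2n_1,\dots,(n_2-1)n_1\}$, $N_2=\{n_2,2n_2,\dots,(n_1-1)n_2\}$, and $C_1=N_1\cup D_0\cup D_1\cup D_2$. The sequence $(s_i)_{i=0}^{n-1}$ is defined by $s_i=1$ if $i\in C_1$ and $s_i=0$ otherwise, viewed over $\mathrm{GF}(q)$; its generator polynomial is $S(x)=\sum_{i\in C_1}x^i\in\mathrm{GF}(q)[x]$. The code $\boldsymbol{C_s}$ is the cyclic code (ideal of $\mathrm{GF}(q)[x]/(x^n-1)$) generated by the minimal polynomial $\frac{x^n-1}{\gcd(x^n-1,S(x))}$ of the sequence. An integer reduced "mod $p$" denotes its image in the prime field $\mathrm{GF}(p)\subseteq \mathrm{GF}(q)$. *)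

theory Defs
  imports "HOL-Computational_Algebra.Computational_Algebra" "HOL-Number_Theory.Number_Theory"
begin

definition whiteman_D :: "nat \<Rightarrow> nat \<Rightarrow> nat \<Rightarrow> int \<Rightarrow> nat \<Rightarrow> nat set" where
  "whiteman_D n1 n2 g u i =
     {nat ((int g ^ s * u ^ i) mod int (n1 * n2)) | s. s < (n1 - 1) * (n2 - 1) div 6}"

definition setN1 :: "nat \<Rightarrow> nat \<Rightarrow> nat set" where
  "setN1 n1 n2 = {k * n1 | k. 1 \<le> k \<and> k \<le> n2 - 1}"

definition setC1 :: "nat \<Rightarrow> nat \<Rightarrow> nat \<Rightarrow> int \<Rightarrow> nat set" where
  "setC1 n1 n2 g u = setN1 n1 n2 \<union> whiteman_D n1 n2 g u 0 \<union> whiteman_D n1 n2 g u 1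
                      \<union> whiteman_D n1 n2 g u 2"

definition seqS :: "nat \<Rightarrow> nat \<Rightarrow> nat \<Rightarrow> int \<Rightarrow> 'a::field_gcd poly" where
  "seqS n1 n2 g u = (\<Sum>i\<in>setC1 n1 n2 g u. Polynomial.monom 1 i)"

definition gen_poly_s :: "nat \<Rightarrow> nat \<Rightarrow> nat \<Rightarrow> int \<Rightarrow> 'a::field_gcd poly" where
  "gen_poly_s n1 n2 g u =
     (Polynomial.monom 1 (n1 * n2) - 1) div gcd (Polynomial.monom 1 (n1 * n2) - 1) (seqS n1 n2 g u)"

definition units_mod :: "nat \<Rightarrow> nat set" where
  "units_mod n = {i. i < n \<and> coprime i n}"

end

theory Submission imports Defs
begin

text \<open>
  Both \<open>x\<^sup>n - 1\<close> and its gcd with \<open>S(x)\<close> split over the extension field, so everything reduces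
  to deciding for which \<open>n\<close>-th roots of unity \<open>z\<close> one has \<open>S(z) = 0\<close>. For \<open>z = 1\<close>, for \<open>z\<close> of
  order \<open>n\<^sub>1\<close> and for \<open>z\<close> of order \<open>n\<^sub>2\<close> the values are \<open>\<Omega>\<close>, \<open>\<Omega>\<^sub>2\<close> and \<open>-\<Omega>\<^sub>1\<close>, since the residues
  of \<open>D\<^sub>i\<close> modulo \<open>n\<^sub>1\<close> and \<open>n\<^sub>2\<close> are equidistributed. For primitive \<open>z\<close>, write \<open>T\<^sub>i\<close> for the sum
  of \<open>z\<^sup>x\<close> over \<open>x \<in> D\<^sub>i\<close>. As \<open>q\<^sup>3\<close> lies in \<open>D\<^sub>3\<close>, we have \<open>S(z) = -1 + T\<^sub>0 + T\<^sub>1 + T\<^sub>2\<close> and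
  (Frobenius) \<open>S(z) ^ q\<^sup>3 = -1 + T\<^sub>3 + T\<^sub>4 + T\<^sub>5\<close>; both vanishing contradicts
  \<open>T\<^sub>0 + \<dots> + T\<^sub>5 = 1\<close>.
\<close>

section \<open>Powers and power sums of roots of unity\<close>

lemma cong_mult_modulus_iff_nat:
  fixes a b c d :: nat
  assumes "coprime c d"
  shows "[a = b] (mod c * d) \<longleftrightarrow> [a = b] (mod c) \<and> [a = b] (mod d)"
  using assms coprime_cong_mult_nat[of a b c d] cong_modulus_mult_nat[of a b c d]
    cong_modulus_mult_nat[of a b d c] by (auto simp: mult.commute)

lemma power_cong_exponent:
  fixes z :: "'a :: monoid_mult"
  assumes "z ^ l = 1" "[a = b] (mod l)"
  shows "z ^ a = z ^ b"
proof -
  have "z ^ k = z ^ (k mod l)" for k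
  proof -
    have "z ^ k = z ^ (l * (k div l) + k mod l)" by simp
    then show ?thesis unfolding power_add power_mult assms(1) by simp
  qed
  then show ?thesis using assms(2) by (metis cong_def)
qed

lemma power_power_commute:
  fixes z :: "'a :: monoid_mult"
  shows "(z ^ a) ^ b = (z ^ b) ^ a"
  by (metis power_mult mult.commute)

text \<open>Raising to the power \<open>a\<close> can be undone by an inverse of \<open>a\<close>
  modulo \<open>b\<close>. This is what separates roots of unity of order \<open>n1\<close> from
  those of order \<open>n2\<close>.\<close>

lemma power_eq_1_coprime:
  fixes z :: "'a :: monoid_mult"
  assumes "z ^ a = 1" "z ^ b = 1" "coprime a b"
  shows "z = 1"
proof -
  obtain x where "[a * x = 1] (mod b)" using cong_solve_coprime_nat[OF assms(3)] by auto
  then have "z ^ (a * x) = z ^ 1" using assms(2) by (rule power_cong_exponent[rotated])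
  then show ?thesis by (simp add: power_mult assms(1))
qed

lemma sum_powers_root_of_unity:
  fixes z :: "'a :: field"
  assumes "z ^ l = 1" "z \<noteq> 1"
  shows "(\<Sum>i<l. z ^ i) = 0"
  using assms by (simp add: sum_gp_strict)

lemma sum_powers_root_of_unity':
  fixes z :: "'a :: field"
  assumes "z ^ l = 1" "z \<noteq> 1" "l > 0"
  shows "(\<Sum>i\<in>{1..<l}. z ^ i) = -1"
proof -
  have "(\<Sum>i<l. z ^ i) = 1 + (\<Sum>i\<in>{1..<l}. z ^ i)"
    using sum.atLeast_Suc_lessThan[of 0 l "\<lambda>i. z ^ i"] assms(3) by (simp add: atLeast0LessThan)
  then show ?thesis using sum_powers_root_of_unity[OF assms(1,2)] by (metis add_eq_0_iff)
qed

text \<open>The powers of \<open>g\<close> run once through the nonzero residues modulo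
  \<open>l\<close>, so this is a full geometric sum with the exponent 0 left out.\<close>

lemma sum_powers_primroot:
  fixes z :: "'a :: field"
  assumes "prime l" "residue_primroot l g" "z ^ l = 1" "z \<noteq> 1"
  shows "(\<Sum>s<l - 1. z ^ (g ^ s)) = -1"
proof -
  have l: "l > 1" "l > 0" "totient l = l - 1" using assms(1) prime_gt_1_nat prime_gt_0_nat totient_prime by blast+
  have "totatives l = {1..<l}" using assms(1) by (auto simp: totatives_prime)
  then have "bij_betw (\<lambda>s. g ^ s mod l) {..<l - 1} {1..<l}"
    using residue_primroot_is_generator[OF l(1) assms(2)] l(3) by simp
  then have "(\<Sum>s<l - 1. z ^ (g ^ s mod l)) = (\<Sum>i\<in>{1..<l}. z ^ i)"
    by (rule sum.reindex_bij_betw)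
  also have "(\<Sum>s<l - 1. z ^ (g ^ s mod l)) = (\<Sum>s<l - 1. z ^ (g ^ s))"
    by (intro sum.cong refl power_cong_exponent[OF assms(3)]) simp
  finally show ?thesis using sum_powers_root_of_unity'[OF assms(3,4) l(2)] by simp
qed

lemma sum_periodic:
  fixes f :: "nat \<Rightarrow> 'a :: comm_semiring_1"
  assumes "\<And>s. f (s + l) = f s"
  shows "(\<Sum>s<c * l. f s) = of_nat c * (\<Sum>s<l. f s)"
proof -
  have *: "f (s + m * l) = f s" for s m
    by (induction m) (simp_all add: assms add.assoc[symmetric] add.commute[of l])
  have "(\<Sum>s<c * l. f s) = (\<Sum>m<c. \<Sum>s\<in>{m * l..<m * l + l}. f s)"
    by (simp add: sum.nat_group)
  moreover have "(\<Sum>s\<in>{m * l..<m * l + l}. f s) = (\<Sum>s<l. f s)" for m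
    using sum.shift_bounds_nat_ivl[of f 0 "m * l" l]
    by (simp add: * atLeast0LessThan add.commute)
  ultimately show ?thesis by simp
qed

text \<open>The exponents \<open>g ^ s\<close> have period \<open>l - 1\<close> modulo
  \<open>l\<close>, so the range consists of \<open>c\<close> full periods, each contributing
  -1.\<close>

lemma sum_powers_primroot_multiple:
  fixes z :: "'a :: field"
  assumes "prime l" "residue_primroot l g" "z ^ l = 1" "z \<noteq> 1"
  shows "(\<Sum>s<c * (l - 1). z ^ (g ^ s)) = - of_nat c"
proof -
  have "ord l g = l - 1" using assms by (auto simp: residue_primroot_def totient_prime)
  then have "[g ^ (s + (l - 1)) = g ^ s] (mod l)" for s
    using cong_mult[OF cong_refl ord, of "g ^ s" g l] by (simp add: power_add)
  then have "z ^ (g ^ (s + (l - 1))) = z ^ (g ^ s)" for s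
    by (rule power_cong_exponent[OF assms(3)])
  then have "(\<Sum>s<c * (l - 1). z ^ (g ^ s)) = of_nat c * (\<Sum>s<l - 1. z ^ (g ^ s))"
    by (rule sum_periodic)
  then show ?thesis unfolding sum_powers_primroot[OF assms] by simp
qed

subsection \<open>Whiteman classes\<close>

text \<open>The natural number \<open>v\<close> stands for the residue of the integer \<open>u\<close> modulo \<open>n\<close>.\<close>
locale whiteman =
  fixes n1 n2 g v n e :: nat
  assumes n1: "prime n1" "odd n1" and n2: "prime n2" "odd n2" and neq: "n1 \<noteq> n2"
    and gcd6: "gcd (n1 - 1) (n2 - 1) = 6"
    and g: "residue_primroot n1 g" "residue_primroot n2 g"
    and v: "[v = g] (mod n1)" "[v = 1] (mod n2)"
    and n_def: "n = n1 * n2"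
    and e_def: "e = (n1 - 1) * (n2 - 1) div 6"
begin

definition D :: "nat \<Rightarrow> nat set" where
  "D i = (\<lambda>s. g ^ s * v ^ i mod n) ` {..<e}"

lemma coprime_n1_n2: "coprime n1 n2"
  using n1 n2 neq primes_coprime by blast

lemma gt1: "n1 > 1" "n2 > 1" "n > 1" "n > 0"
proof -
  show "n1 > 1" "n2 > 1" using n1 n2 prime_gt_1_nat by blast+
  then show "n > 1" unfolding n_def by (rule less_1_mult)
  then show "n > 0" by simp
qed

lemma six_dvd: "6 dvd n1 - 1" "6 dvd n2 - 1"
  by (metis gcd6 gcd_dvd1) (metis gcd6 gcd_dvd2)

lemma six_e: "6 * e = (n1 - 1) * (n2 - 1)"
  using six_dvd by (simp add: e_def)

text \<open>The gcd times the lcm is the product, and the gcd is 6. Thus \<open>e\<close> is the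
  common period of the powers of \<open>g\<close> modulo \<open>n1\<close> and \<open>n2\<close>,
  which is how it is used below.\<close>

lemma e_eq_lcm: "e = lcm (n1 - 1) (n2 - 1)"
proof -
  have "6 * e = 6 * lcm (n1 - 1) (n2 - 1)"
    using prod_gcd_lcm_nat[of "n1 - 1" "n2 - 1"] six_e gcd6 by metis
  then show ?thesis by simp
qed

lemma e_pos: "e > 0"
  using gt1 by (simp add: e_eq_lcm lcm_pos_nat)

text \<open>Chinese remainder theorem: the element \<open>g ^ s * v ^ i\<close> has discrete
  logarithm \<open>s + i\<close> modulo \<open>n1\<close> and \<open>s\<close> modulo
  \<open>n2\<close>, to base \<open>g\<close> of order \<open>n1 - 1\<close> and
  \<open>n2 - 1\<close>. The class index is the difference of the two logarithms.\<close>

lemma cong_D_iff: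
  "[g ^ s * v ^ i = g ^ t * v ^ j] (mod n) \<longleftrightarrow>
     [s + i = t + j] (mod n1 - 1) \<and> [s = t] (mod n2 - 1)"
proof -
  have cop: "coprime n1 g" "coprime n2 g"
    and ord: "ord n1 g = n1 - 1" "ord n2 g = n2 - 1"
    using g n1 n2 by (auto simp: residue_primroot_def totient_prime)
  have 1: "[g ^ s * v ^ i = g ^ (s + i)] (mod n1)" for s i
    using v(1) unfolding power_add by (intro cong_mult cong_pow) auto
  have 2: "[g ^ s * v ^ i = g ^ s] (mod n2)" for s i
    using cong_mult[OF cong_refl cong_pow[OF v(2)], of "g ^ s" i] by simp
  have "[g ^ s * v ^ i = g ^ t * v ^ j] (mod n1) \<longleftrightarrow> [s + i = t + j] (mod n1 - 1)"
    using order_divides_expdiff[OF cop(1)] 1 ord by (metis cong_sym cong_trans)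
  moreover have "[g ^ s * v ^ i = g ^ t * v ^ j] (mod n2) \<longleftrightarrow> [s = t] (mod n2 - 1)"
    using order_divides_expdiff[OF cop(2)] 2 ord by (metis cong_sym cong_trans)
  ultimately show ?thesis
    by (simp add: n_def cong_mult_modulus_iff_nat[OF coprime_n1_n2])
qed

lemma cong_e: "[s mod e = s] (mod n1 - 1)" "[s mod e = s] (mod n2 - 1)"
  unfolding e_eq_lcm by (auto simp: cong_def mod_mod_cancel)

lemma D_iff: "x \<in> D i \<longleftrightarrow> (\<exists>s. x = g ^ s * v ^ i mod n)"
proof
  assume "\<exists>s. x = g ^ s * v ^ i mod n"
  then obtain s where s: "x = g ^ s * v ^ i mod n" ..
  have "[g ^ (s mod e) * v ^ i = g ^ s * v ^ i] (mod n)"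
    unfolding cong_D_iff using cong_e[of s] by (auto intro: cong_add)
  then have "x = g ^ (s mod e) * v ^ i mod n" by (simp add: s cong_def)
  then show "x \<in> D i" using e_pos by (auto simp: D_def)
qed (auto simp: D_def)

text \<open>Since 6 divides both \<open>n1 - 1\<close> and \<open>n2 - 1\<close>, the difference of
  the two logarithms is well defined modulo 6, and it is the class index.\<close>

lemma disjoint_D: assumes "i < 6" "j < 6" "i \<noteq> j" shows "D i \<inter> D j = {}"
proof (rule ccontr)
  assume "D i \<inter> D j \<noteq> {}"
  then obtain s t where "g ^ s * v ^ i mod n = g ^ t * v ^ j mod n"
    by (auto simp: D_def)
  then have "[s + i = t + j] (mod n1 - 1)" "[s = t] (mod n2 - 1)"
    using cong_D_iff by (auto simp: cong_def)
  then have c: "[s + i = t + j] (mod 6)" "[s = t] (mod 6)"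
    using six_dvd cong_dvd_modulus_nat by blast+
  then have "[s + i = s + j] (mod 6)"
    by (meson cong_add cong_refl cong_sym cong_trans)
  then have "[i = j] (mod 6)" by (simp add: cong_add_lcancel_nat)
  then show False using assms by (simp add: cong_def)
qed

lemma coprime_gv: "coprime g n" "coprime v n"
proof -
  have "coprime n1 g" "coprime n2 g" using g by (auto simp: residue_primroot_def)
  moreover have "coprime v n1" "coprime v n2"
    using v calculation cong_imp_coprime cong_sym coprime_1_left coprime_commute by metis+
  ultimately show "coprime g n" "coprime v n" by (auto simp: n_def coprime_commute)
qed

lemma inj_on_D: "inj_on (\<lambda>s. g ^ s * v ^ i mod n) {..<e}"
proof (rule inj_onI)
  fix s t assume st: "s \<in> {..<e}" "t \<in> {..<e}" "g ^ s * v ^ i mod n = g ^ t * v ^ i mod n"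
  then have "[s + i = t + i] (mod n1 - 1)" "[s = t] (mod n2 - 1)"
    using cong_D_iff by (auto simp: cong_def)
  then have "[s = t] (mod e)"
    unfolding e_eq_lcm by (intro cong_cong_lcm_nat) (simp_all add: cong_add_rcancel_nat)
  then show "s = t" using st by (simp add: cong_def)
qed

lemma card_D: "card (D i) = e"
  using inj_on_D by (simp add: D_def card_image)

lemma finite_D [simp]: "finite (D i)" by (simp add: D_def)

lemma D_subset: "D i \<subseteq> units_mod n"
  using coprime_gv gt1 by (auto simp: D_def units_mod_def)

text \<open>By counting: six disjoint sets of \<open>e\<close> units each already exhaust the
  \<open>totient n\<close> units.\<close>

lemma Union_D: "(\<Union>i<6. D i) = units_mod n"
proof (rule card_subset_eq)
  show "finite (units_mod n)" by (simp add: units_mod_def)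
  show "(\<Union>i<6. D i) \<subseteq> units_mod n" using D_subset by blast
  have "card (\<Union>i<6. D i) = (\<Sum>i<6. card (D i))"
    using disjoint_D by (intro card_UN_disjoint) auto
  also have "\<dots> = 6 * e" by (simp add: card_D)
  also have "\<dots> = totient n"
    unfolding six_e n_def using n1 n2 by (simp add: totient_mult_coprime coprime_n1_n2 totient_prime)
  also have "units_mod n = totatives n"
    unfolding totatives_def units_mod_def using gt1
    by (auto intro!: Nat.gr0I simp: order.order_iff_strict)
  then have "totient n = card (units_mod n)" by (simp add: totient_def)
  finally show "card (\<Union>i<6. D i) = card (units_mod n)" .
qed

lemma D_mult: assumes "x \<in> D i" "y \<in> D j" shows "x * y mod n \<in> D (i + j)"
proof -
  obtain s t where "x = g ^ s * v ^ i mod n" "y = g ^ t * v ^ j mod n"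
    using assms D_iff by metis
  then have "x * y mod n = g ^ (s + t) * v ^ (i + j) mod n"
    by (simp add: mod_mult_eq power_add mult_ac)
  then show ?thesis using D_iff by blast
qed

text \<open>This makes the class index meaningful modulo 6. The unit \<open>v ^ 6\<close> lies in
  some \<open>D j\<close> with \<open>j < 6\<close>, and comparing logarithms modulo 6 forces
  \<open>j = 0\<close>.\<close>

lemma v6: "\<exists>t. [v ^ 6 = g ^ t] (mod n)"
proof -
  have "v ^ 6 mod n \<in> units_mod n" using coprime_gv gt1 by (auto simp: units_mod_def)
  then obtain j where j: "j < 6" "v ^ 6 mod n \<in> D j" using Union_D by auto
  then obtain t where "v ^ 6 mod n = g ^ t * v ^ j mod n" using D_iff by blast
  then have *: "[g ^ 0 * v ^ 6 = g ^ t * v ^ j] (mod n)" by (simp add: cong_def)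
  then have "[0 + 6 = t + j] (mod 6)" "[0 = t] (mod 6)"
    using six_dvd cong_dvd_modulus_nat cong_D_iff by blast+
  then have "(t + j) mod 6 = 0" "t mod 6 = 0" by (simp_all add: cong_def)
  then have "j = 0" using j(1) by presburger
  with * show ?thesis by auto
qed

lemma D_add_6: "D (i + 6) = D i"
proof (rule card_subset_eq)
  obtain t where t: "[v ^ 6 = g ^ t] (mod n)" using v6 by blast
  show "D (i + 6) \<subseteq> D i"
  proof
    fix x assume "x \<in> D (i + 6)"
    then obtain s where "x = g ^ s * v ^ (i + 6) mod n" using D_iff by blast
    moreover have "[g ^ s * v ^ i * v ^ 6 = g ^ s * v ^ i * g ^ t] (mod n)"
      using t by (intro cong_mult) auto
    ultimately have "x = g ^ (s + t) * v ^ i mod n"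
      by (simp add: power_add cong_def mult_ac)
    then show "x \<in> D i" using D_iff by blast
  qed
qed (auto simp: card_D)

text \<open>The image is contained in \<open>D (i + j)\<close>, and since \<open>a\<close> is a unit
  it has \<open>e\<close> elements, as many as \<open>D (i + j)\<close> has.\<close>

lemma D_mult_image: assumes "a mod n \<in> D j" shows "(\<lambda>x. a * x mod n) ` D i = D (i + j)"
  and "inj_on (\<lambda>x. a * x mod n) (D i)"
proof -
  have cop: "coprime a n"
  proof -
    have "coprime (a mod n) n" using assms D_subset[of j] by (auto simp: units_mod_def)
    then show ?thesis using gt1 by simp
  qed
  show inj: "inj_on (\<lambda>x. a * x mod n) (D i)"
  proof (rule inj_onI)
    fix x y assume xy: "x \<in> D i" "y \<in> D i" "a * x mod n = a * y mod n"
    then have "[x = y] (mod n)" using cop by (simp add: cong_mult_lcancel_nat flip: cong_def)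
    moreover have "x < n" "y < n" using xy D_subset[of i] by (auto simp: units_mod_def)
    ultimately show "x = y" by (simp add: cong_def)
  qed
  show "(\<lambda>x. a * x mod n) ` D i = D (i + j)"
  proof (rule card_subset_eq)
    show "(\<lambda>x. a * x mod n) ` D i \<subseteq> D (i + j)"
      using D_mult[OF _ assms] by (auto simp: mod_simps mult.commute)
    show "card ((\<lambda>x. a * x mod n) ` D i) = card (D (i + j))"
      using inj by (simp add: card_image card_D)
  qed simp
qed

subsection \<open>Sums of roots of unity over the classes\<close>

definition T :: "nat \<Rightarrow> 'a :: field \<Rightarrow> 'a" where
  "T i z = (\<Sum>x\<in>D i. z ^ x)"

definition S :: "'a :: field \<Rightarrow> 'a" where
  "S z = (\<Sum>x\<in>setN1 n1 n2 \<union> D 0 \<union> D 1 \<union> D 2. z ^ x)"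

lemma T_eq: "z ^ n = 1 \<Longrightarrow> T i z = (\<Sum>s<e. z ^ (g ^ s * v ^ i))"
  unfolding T_def D_def
  by (subst sum.reindex[OF inj_on_D]) (auto intro!: sum.cong power_cong_exponent)

text \<open>Modulo \<open>n1\<close> the exponent is \<open>g ^ i * g ^ s\<close>. With
  \<open>z ^ (g ^ i)\<close> as the new base, the sum runs over \<open>(n2 - 1) div 6\<close> full
  periods, and its value no longer depends on \<open>i\<close>.\<close>

lemma T_root_n1:
  fixes z :: "'a :: field"
  assumes "z ^ n1 = 1" "z \<noteq> 1"
  shows "T i z = - of_nat ((n2 - 1) div 6)"
proof -
  have z: "z ^ n = 1" using assms by (simp add: n_def power_mult)
  let ?w = "z ^ (g ^ i)"
  have "coprime n1 (g ^ i)" using coprime_gv by (simp add: n_def coprime_commute)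
  then have "?w \<noteq> 1" using assms power_eq_1_coprime by blast
  moreover have "?w ^ n1 = 1" using assms(1) by (simp add: power_power_commute[of _ _ n1])
  ultimately have w: "?w ^ n1 = 1" "?w \<noteq> 1" by auto
  have "T i z = (\<Sum>s<e. ?w ^ (g ^ s))"
    unfolding T_eq[OF z]
  proof (intro sum.cong refl)
    fix s
    have "[g ^ s * v ^ i = g ^ i * g ^ s] (mod n1)"
      using v(1) by (subst mult.commute) (intro cong_mult cong_pow cong_refl)
    then show "z ^ (g ^ s * v ^ i) = ?w ^ (g ^ s)"
      unfolding power_mult[symmetric] by (rule power_cong_exponent[OF assms(1)])
  qed
  also have "\<dots> = - of_nat ((n2 - 1) div 6)"
  proof -
    have e: "e = (n2 - 1) div 6 * (n1 - 1)"
      using six_dvd(2) by (auto simp: e_def)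
    show ?thesis unfolding e by (rule sum_powers_primroot_multiple[OF n1(1) g(1) w])
  qed
  finally show ?thesis .
qed

text \<open>Here \<open>v\<close> is 1 modulo \<open>n2\<close>, so the class index drops out of the
  exponent at once, leaving \<open>(n1 - 1) div 6\<close> full periods.\<close>

lemma T_root_n2:
  fixes z :: "'a :: field"
  assumes "z ^ n2 = 1" "z \<noteq> 1"
  shows "T i z = - of_nat ((n1 - 1) div 6)"
proof -
  have z: "z ^ n = 1"
    unfolding n_def power_mult power_power_commute[of z n1] assms(1) by simp
  have "T i z = (\<Sum>s<e. z ^ (g ^ s))"
    unfolding T_eq[OF z]
  proof (intro sum.cong refl)
    fix s
    have "[g ^ s * v ^ i = g ^ s] (mod n2)"
      using cong_mult[OF cong_refl cong_pow[OF v(2)], of "g ^ s" i] by simp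
    then show "z ^ (g ^ s * v ^ i) = z ^ (g ^ s)"
      by (rule power_cong_exponent[OF assms(1)])
  qed
  also have "\<dots> = - of_nat ((n1 - 1) div 6)"
  proof -
    have e: "e = (n1 - 1) div 6 * (n2 - 1)"
      using six_dvd(1) by (auto simp: e_def)
    show ?thesis unfolding e by (rule sum_powers_primroot_multiple[OF n2(1) g(2) assms])
  qed
  finally show ?thesis .
qed

text \<open>Multiples of \<open>n1\<close> are not units and the classes are disjoint, so the sum
  over the union splits.\<close>

lemma S_eq: "S z = (\<Sum>k\<in>{1..<n2}. (z ^ n1) ^ k) + T 0 z + T 1 z + T 2 z"
proof -
  have N1: "setN1 n1 n2 = (\<lambda>k. k * n1) ` {1..<n2}"
    using gt1 by (force simp: setN1_def)
  have "\<not> coprime (k * n1) n" for k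
    using gt1 coprime_common_divisor[of "k * n1" n n1] by (auto simp: n_def)
  then have "setN1 n1 n2 \<inter> D i = {}" for i
    using D_subset[of i] by (auto simp: N1 units_mod_def)
  moreover have "finite (setN1 n1 n2)" by (simp add: N1)
  ultimately have "S z = (\<Sum>x\<in>setN1 n1 n2. z ^ x) + T 0 z + T 1 z + T 2 z"
    unfolding S_def T_def using disjoint_D[of 0 1] disjoint_D[of 0 2] disjoint_D[of 1 2]
    by (subst sum.union_disjoint; simp add: Int_Un_distrib2)+
  also have "(\<Sum>x\<in>setN1 n1 n2. z ^ x) = (\<Sum>k\<in>{1..<n2}. (z ^ n1) ^ k)"
    unfolding N1 using gt1 by (subst sum.reindex) (auto simp: inj_on_def mult.commute simp flip: power_mult)
  finally show ?thesis .
qed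

lemma S_1: "S (1 :: 'a :: field) = of_nat ((n1 + 1) * (n2 - 1) div 2)"
proof -
  obtain a where a: "n1 = 2 * a + 1" using n1(2) by (elim oddE)
  then have "6 * e = 2 * a * (n2 - 1)" using six_e by simp
  then have "(n1 + 1) * (n2 - 1) div 2 = (n2 - 1) + 3 * e" using a by simp
  moreover have "S (1 :: 'a) = of_nat ((n2 - 1) + 3 * e)"
    by (simp add: S_eq T_def card_D algebra_simps)
  ultimately show ?thesis by simp
qed

text \<open>With \<open>n2 - 1 = 6 * c\<close>, the multiples of \<open>n1\<close> contribute
  \<open>6 * c\<close> ones and each of the three classes contributes \<open>- c\<close>.\<close>

lemma S_root_n1:
  fixes z :: "'a :: field"
  assumes "z ^ n1 = 1" "z \<noteq> 1"
  shows "S z = of_nat ((n2 - 1) div 2)"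
proof -
  obtain c where c: "n2 - 1 = 6 * c" using six_dvd(2) by (elim dvdE)
  then show ?thesis
    by (simp add: S_eq assms T_root_n1[OF assms])
qed

text \<open>With \<open>n1 - 1 = 6 * c\<close>, the multiples of \<open>n1\<close> contribute -1 and
  each of the three classes contributes \<open>- c\<close>.\<close>

lemma S_root_n2:
  fixes z :: "'a :: field"
  assumes "z ^ n2 = 1" "z \<noteq> 1"
  shows "S z = - of_nat ((n1 + 1) div 2)"
proof -
  obtain c where c: "n1 - 1 = 6 * c" using six_dvd(1) by (elim dvdE)
  then have c': "(n1 - 1) div 6 = c" "(n1 + 1) div 2 = 3 * c + 1" using gt1 by simp_all
  have "(z ^ n1) ^ n2 = 1"
    unfolding power_power_commute[of z n1] assms(1) by simp
  moreover have "z ^ n1 \<noteq> 1" using assms coprime_n1_n2 power_eq_1_coprime by blast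
  ultimately have "(\<Sum>k\<in>{1..<n2}. (z ^ n1) ^ k) = -1"
    using gt1 by (intro sum_powers_root_of_unity') auto
  then show ?thesis
    unfolding S_eq T_root_n2[OF assms] c' by (simp add: algebra_simps)
qed

lemma S_primitive:
  fixes z :: "'a :: field"
  assumes "z ^ n = 1" "z ^ n1 \<noteq> 1"
  shows "S z = - 1 + T 0 z + T 1 z + T 2 z"
proof -
  have "(z ^ n1) ^ n2 = 1" using assms by (simp add: n_def power_mult)
  then have "(\<Sum>k\<in>{1..<n2}. (z ^ n1) ^ k) = -1"
    using gt1 assms by (intro sum_powers_root_of_unity') auto
  then show ?thesis by (simp add: S_eq)
qed

text \<open>The nonunits are the multiples of \<open>n1\<close> and of \<open>n2\<close>,
  overlapping only in 0. Both sets give geometric sums equal to 0, so their union gives -1, the term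
  at 0 being counted twice, while the sum over all residues is 0.\<close>

lemma sum_units_primitive:
  fixes z :: "'a :: field"
  assumes "z ^ n = 1" "z ^ n1 \<noteq> 1" "z ^ n2 \<noteq> 1"
  shows "(\<Sum>x\<in>units_mod n. z ^ x) = 1"
proof -
  let ?A = "(\<lambda>k. n1 * k) ` {..<n2}" and ?B = "(\<lambda>k. n2 * k) ` {..<n1}"
  have "(\<Sum>x<n. z ^ x) = 0" using assms by (intro sum_powers_root_of_unity) auto
  have "{..<n} - units_mod n = ?A \<union> ?B"
  proof (intro equalityI subsetI)
    fix x assume "x \<in> {..<n} - units_mod n"
    then have x: "x < n" "\<not> coprime x n" by (auto simp: units_mod_def)
    then have "n1 dvd x \<or> n2 dvd x"
      using n1 n2 by (metis coprime_commute coprime_mult_right_iff n_def prime_imp_coprime)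
    then show "x \<in> ?A \<union> ?B" using x(1) by (auto simp: n_def mult.commute elim!: dvdE)
  next
    fix x assume "x \<in> ?A \<union> ?B"
    then show "x \<in> {..<n} - units_mod n" using gt1 by (auto simp: n_def units_mod_def)
  qed
  have "?A \<inter> ?B = {0}"
  proof (intro equalityI subsetI)
    fix x assume x: "x \<in> ?A \<inter> ?B"
    then obtain k l where "x = n1 * k" "x = n2 * l" by blast
    then have "n1 dvd x" "n2 dvd x" by (metis dvd_triv_left)+
    then have "n dvd x" unfolding n_def using coprime_n1_n2 by (rule divides_mult)
    moreover have "x < n" using x gt1 by (auto simp: n_def)
    ultimately show "x \<in> {0}" using nat_dvd_not_less by blast
  qed (use gt1 in auto)
  have z: "(z ^ n1) ^ n2 = 1" "(z ^ n2) ^ n1 = 1"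
    using assms(1) power_power_commute[of z n1 n2] by (simp_all add: n_def power_mult)
  have "(\<Sum>x\<in>?A. z ^ x) = (\<Sum>k<n2. (z ^ n1) ^ k)" "(\<Sum>x\<in>?B. z ^ x) = (\<Sum>k<n1. (z ^ n2) ^ k)"
    using gt1 by (subst sum.reindex; simp add: inj_on_def power_mult)+
  then have A: "(\<Sum>x\<in>?A. z ^ x) = 0" and B: "(\<Sum>x\<in>?B. z ^ x) = 0"
    using sum_powers_root_of_unity z assms by simp_all
  have "(\<Sum>x\<in>?A \<union> ?B. z ^ x) = - 1"
    using sum.union_inter[of ?A ?B "\<lambda>x. z ^ x"] A B \<open>?A \<inter> ?B = {0}\<close>
    by (simp add: eq_neg_iff_add_eq_0)
  moreover have "(\<Sum>x<n. z ^ x) = (\<Sum>x\<in>{..<n} - units_mod n. z ^ x) + (\<Sum>x\<in>units_mod n. z ^ x)"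
    by (rule sum.subset_diff) (auto simp: units_mod_def)
  ultimately show ?thesis
    using \<open>(\<Sum>x<n. z ^ x) = 0\<close> \<open>{..<n} - units_mod n = ?A \<union> ?B\<close> by simp
qed

lemma sum_T_primitive:
  fixes z :: "'a :: field"
  assumes "z ^ n = 1" "z ^ n1 \<noteq> 1" "z ^ n2 \<noteq> 1"
  shows "T 0 z + T 1 z + T 2 z + T 3 z + T 4 z + T 5 z = 1"
proof -
  have "(\<Sum>x\<in>units_mod n. z ^ x) = (\<Sum>i<6. T i z)"
    unfolding Union_D[symmetric] T_def using disjoint_D by (intro sum.UNION_disjoint) auto
  then show ?thesis using sum_units_primitive[OF assms]
    by (simp add: eval_nat_numeral)
qed

lemma T_power:
  fixes z :: "'a :: field"
  assumes "z ^ n = 1" "a mod n \<in> D j"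
  shows "T i (z ^ a) = T (i + j) z"
proof -
  have "T (i + j) z = (\<Sum>x\<in>D i. z ^ (a * x mod n))"
    unfolding T_def D_mult_image(1)[OF assms(2), of i, symmetric]
    by (subst sum.reindex[OF D_mult_image(2)[OF assms(2)]]) simp
  also have "\<dots> = (\<Sum>x\<in>D i. z ^ (a * x))"
    by (intro sum.cong refl power_cong_exponent[OF assms(1)]) simp
  finally show ?thesis by (simp add: T_def power_mult)
qed

lemma S_primitive_nonzero:
  fixes z :: "'a :: field"
  assumes "z ^ n = 1" "z ^ n1 \<noteq> 1" "z ^ n2 \<noteq> 1" "a mod n \<in> D 3" "S z = 0"
  shows "S (z ^ a) \<noteq> 0"
proof
  assume 0: "S (z ^ a) = 0"
  have "coprime (a mod n) n" using assms D_subset[of 3] by (auto simp: units_mod_def)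
  then have "coprime a n" using gt1 by simp
  then have "coprime a n2" by (simp add: n_def)
  have "(z ^ n1) ^ n2 = 1" using assms by (simp add: n_def power_mult)
  then have "(z ^ n1) ^ a \<noteq> 1" using power_eq_1_coprime[of "z ^ n1" a n2] \<open>coprime a n2\<close> assms by blast
  then have "(z ^ a) ^ n1 \<noteq> 1" by (simp add: power_power_commute[of _ a])
  moreover have "(z ^ a) ^ n = 1" using assms(1) by (simp add: power_power_commute[of _ a])
  ultimately have "S (z ^ a) = - 1 + T 3 z + T 4 z + T 5 z"
    using S_primitive[of "z ^ a"] T_power[OF assms(1,4), of 0] T_power[OF assms(1,4), of 1]
      T_power[OF assms(1,4), of 2] by simp
  then have "T 3 z + T 4 z + T 5 z = 1" using 0 by (simp add: algebra_simps)
  moreover have "T 0 z + T 1 z + T 2 z = 1"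
    using S_primitive[OF assms(1,2)] assms(5) by (simp add: algebra_simps)
  \<comment> \<open>Both half sums equal 1 and so does the total; the contradiction holds in every
    characteristic, including 2.\<close>
  ultimately have "(1 :: 'a) + 1 = 1"
    using sum_T_primitive[OF assms(1-3)] by (simp add: add.assoc)
  then show False by (metis add_cancel_right_right one_neq_zero)
qed

text \<open>The coefficients of S(x) are 0 and 1, so iterated Frobenius acts only on the
  argument.\<close>

lemma S_frobenius:
  assumes "prime CHAR('a :: field)"
  shows "S (z :: 'a) ^ (CHAR('a) ^ k) = S (z ^ (CHAR('a) ^ k))"
  unfolding S_def freshmans_dream_sum'[OF assms refl]
  by (intro sum.cong refl) (rule power_power_commute)

text \<open>Cubing triples the class index, and 3, 9 and 15 agree modulo 6. The resulting shift by 3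
  exchanges the two halves of the classes, whichever odd class \<open>q\<close> lies in.\<close>

lemma cube_in_D3:
  assumes "q mod n \<in> D 1 \<union> D 3 \<union> D 5"
  shows "q ^ 3 mod n \<in> D 3"
proof -
  have *: "q ^ 3 mod n \<in> D (i + i + i)" if "q mod n \<in> D i" for i
    using D_mult[OF D_mult[OF that that] that] by (simp add: mod_simps eval_nat_numeral mult.assoc)
  consider "q mod n \<in> D 1" | "q mod n \<in> D 3" | "q mod n \<in> D 5" using assms by blast
  then show ?thesis
  proof cases
    case 1
    then show ?thesis using *[of 1] by (simp add: numeral_3_eq_3)
  next
    case 2
    then show ?thesis using *[of 3] D_add_6[of 3] by simp
  next
    case 3
    then show ?thesis using *[of 5] D_add_6[of 3] D_add_6[of 9] by simp
  qed
qed

end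

subsection \<open>Gcds of polynomials splitting in an extension\<close>

text \<open>Induction on the factors: each linear factor divides either \<open>Q\<close> or the
  cofactor and is cancelled there. Injectivity of \<open>b\<close> keeps the roots simple, so a
  monic divisor is determined by its roots.\<close>

lemma monic_dvd_prod_linear:
  fixes b :: "'i \<Rightarrow> 'a :: field"
  assumes "finite A" "inj_on b A" "lead_coeff Q = 1" "Q dvd (\<Prod>i\<in>A. [:- b i, 1:])"
  shows "Q = (\<Prod>i\<in>{i\<in>A. poly Q (b i) = 0}. [:- b i, 1:])"
  using assms
proof (induction A arbitrary: Q rule: finite_induct)
  case empty
  moreover have "Q \<noteq> 0" using empty.prems by auto
  ultimately have "degree Q = 0" by (simp add: is_unit_iff_degree)
  then show ?case using empty.prems by (auto elim!: degree_eq_zeroE)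
next
  case (insert a A)
  let ?L = "[:- b a, 1:]" and ?P = "\<Prod>i\<in>A. [:- b i, 1:]"
  obtain R where R: "?L * ?P = Q * R" using insert.prems insert.hyps by (auto elim: dvdE)
  have inj: "inj_on b A" "b a \<notin> b ` A" using insert.prems insert.hyps by auto
  show ?case
  proof (cases "poly Q (b a) = 0")
    case True
    then obtain Q' where Q': "Q = ?L * Q'" by (auto simp: poly_eq_0_iff_dvd)
    then have "?L * ?P = ?L * (Q' * R)" using R by (simp only: mult.assoc)
    then have "?P = Q' * R" by (subst (asm) mult_cancel_left) auto
    moreover have "lead_coeff Q' = 1" using insert.prems(2) unfolding Q' lead_coeff_mult by simp
    ultimately have "Q' = (\<Prod>i\<in>{i\<in>A. poly Q' (b i) = 0}. [:- b i, 1:])"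
      using insert.IH[OF inj(1)] by simp
    moreover have "{i\<in>insert a A. poly Q (b i) = 0} = insert a {i\<in>A. poly Q' (b i) = 0}"
      using inj(2) by (auto simp: Q' image_iff)
    ultimately show ?thesis using insert.hyps by (simp add: Q')
  next
    case False
    have "poly (Q * R) (b a) = 0" unfolding R[symmetric] by simp
    then have "poly R (b a) = 0" using False by simp
    then obtain R' where R': "R = ?L * R'" by (auto simp: poly_eq_0_iff_dvd)
    then have "?L * ?P = ?L * (Q * R')" using R by (simp only: mult.left_commute)
    then have "?P = Q * R'" by (subst (asm) mult_cancel_left) auto
    then have "Q = (\<Prod>i\<in>{i\<in>A. poly Q (b i) = 0}. [:- b i, 1:])"
      using insert.IH[OF inj(1)] insert.prems(2) by simp
    moreover have "{i\<in>insert a A. poly Q (b i) = 0} = {i\<in>A. poly Q (b i) = 0}"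
      using False by auto
    ultimately show ?thesis by simp
  qed
qed

lemma monom_minus_1_dvd:
  assumes "j dvd n"
  shows "(Polynomial.monom 1 j - 1 :: 'a :: comm_ring_1 poly) dvd Polynomial.monom 1 n - 1"
proof -
  obtain k where "n = j * k" using assms by (elim dvdE)
  then have "Polynomial.monom 1 n = (Polynomial.monom 1 j :: 'a poly) ^ k"
    by (simp add: monom_power)
  then show ?thesis by (metis dvd_triv_left power_diff_1_eq)
qed

lemma lead_coeff_monom_minus_1:
  assumes "j > 0"
  shows "degree (Polynomial.monom 1 j - 1 :: 'a :: comm_ring_1 poly) = j"
    and "lead_coeff (Polynomial.monom 1 j - 1 :: 'a poly) = 1"
proof -
  have c: "Polynomial.coeff (Polynomial.monom 1 j - 1 :: 'a poly) j = 1"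
    using assms by simp
  have "degree (Polynomial.monom 1 j - 1 :: 'a poly) \<le> j"
    by (intro degree_diff_le degree_monom_le) simp
  then show "degree (Polynomial.monom 1 j - 1 :: 'a poly) = j"
    using c by (intro antisym le_degree) simp_all
  then show "lead_coeff (Polynomial.monom 1 j - 1 :: 'a poly) = 1" using c by simp
qed

text \<open>Both sides are monic of degree \<open>n\<close> and vanish at the same \<open>n\<close>
  distinct points.\<close>

lemma monom_minus_1_eq_prod:
  fixes \<beta> :: "'a :: field"
  assumes "\<beta> ^ n = 1" "inj_on (\<lambda>i. \<beta> ^ i) {..<n}" "n > 0"
  shows "Polynomial.monom 1 n - 1 = (\<Prod>i<n. [:- (\<beta> ^ i), 1:])"
proof (rule poly_eqI_degree_lead_coeff[where n = n and A = "(\<lambda>i. \<beta> ^ i) ` {..<n}"])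
  have deg: "degree (\<Prod>i<n. [:- (\<beta> ^ i), 1:]) = n"
    by (subst degree_prod_eq_sum_degree) auto
  have "lead_coeff (\<Prod>i<n. [:- (\<beta> ^ i), 1:]) = 1" by (simp add: lead_coeff_prod)
  then show "Polynomial.coeff (Polynomial.monom 1 n - 1) n = Polynomial.coeff (\<Prod>i<n. [:- (\<beta> ^ i), 1:]) n"
    using deg assms(3) by simp
  show "degree (\<Prod>i<n. [:- (\<beta> ^ i), 1:]) \<le> n" using deg by simp
  show "n \<le> card ((\<lambda>i. \<beta> ^ i) ` {..<n})" using assms(2) by (simp add: card_image)
  show "degree (Polynomial.monom 1 n - 1 :: 'a poly) \<le> n"
    by (subst lead_coeff_monom_minus_1(1)[OF assms(3)]) simp
next
  fix z assume "z \<in> (\<lambda>i. \<beta> ^ i) ` {..<n}"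
  then obtain i where i: "i < n" "z = \<beta> ^ i" by auto
  have "z ^ n = 1" unfolding i power_power_commute[of \<beta> i] assms(1) by simp
  moreover have "poly (\<Prod>i<n. [:- (\<beta> ^ i), 1:]) z = 0" using i by (auto simp: poly_prod)
  ultimately show "poly (Polynomial.monom 1 n - 1) z = poly (\<Prod>i<n. [:- (\<beta> ^ i), 1:]) z"
    by (simp add: poly_monom)
qed

section \<open>Field embeddings, and gcds read off from roots in the larger field\<close>

locale field_embedding =
  fixes \<phi> :: "'a :: field_gcd \<Rightarrow> 'b :: field"
  assumes inj: "inj \<phi>" and one: "\<phi> 1 = 1"
    and add: "\<phi> (x + y) = \<phi> x + \<phi> y" and mult: "\<phi> (x * y) = \<phi> x * \<phi> y"
begin

lemma zero: "\<phi> 0 = 0"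
  by (metis add add.right_neutral add_cancel_right_right)

lemma eq_0_iff: "\<phi> x = 0 \<longleftrightarrow> x = 0"
  using inj zero by (metis injD)

lemma diff: "\<phi> (x - y) = \<phi> x - \<phi> y"
  using add[of "x - y" y] by (simp add: algebra_simps)

lemma of_nat: "\<phi> (of_nat k) = of_nat k"
  by (induction k) (simp_all add: zero one add)

lemma sum: "\<phi> (\<Sum>i\<in>A. f i) = (\<Sum>i\<in>A. \<phi> (f i))"
  by (induction A rule: infinite_finite_induct) (simp_all add: zero add)

abbreviation lift :: "'a poly \<Rightarrow> 'b poly" where "lift \<equiv> map_poly \<phi>"

lemma coeff_lift: "Polynomial.coeff (lift P) i = \<phi> (Polynomial.coeff P i)"
  by (simp add: coeff_map_poly zero)

lemma lift_add: "lift (P + Q) = lift P + lift Q"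
  and lift_diff: "lift (P - Q) = lift P - lift Q"
  and lift_mult: "lift (P * Q) = lift P * lift Q"
  by (simp_all add: poly_eq_iff coeff_lift coeff_mult add diff mult sum)

lemma lift_sum: "lift (\<Sum>i\<in>A. f i) = (\<Sum>i\<in>A. lift (f i))"
  by (induction A rule: infinite_finite_induct) (simp_all add: lift_add)

lemma lift_1: "lift 1 = 1"
  by (simp add: one)

lemma lift_monom: "lift (Polynomial.monom 1 i) = Polynomial.monom 1 i"
  by (simp add: map_poly_monom zero one)

lemma lift_inject: "lift P = lift Q \<longleftrightarrow> P = Q"
  using inj by (auto simp: poly_eq_iff coeff_lift inj_eq)

lemma lift_dvd: "P dvd Q \<Longrightarrow> lift P dvd lift Q"
  by (auto simp: lift_mult elim!: dvdE)

lemma lead_coeff_lift: "lead_coeff (lift P) = \<phi> (lead_coeff P)"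
  using degree_map_poly[of \<phi> P] by (simp add: coeff_lift eq_0_iff)

lemma lift_gcd:
  assumes P: "lift P = (\<Prod>i\<in>A. [:- b i, 1:])" and A: "finite A" "inj_on b A"
  shows "lift (gcd P Q) = (\<Prod>i\<in>{i\<in>A. poly (lift Q) (b i) = 0}. [:- b i, 1:])"
proof -
  have "P \<noteq> 0" using P A(1) by (auto simp: prod_zero_iff)
  then have "gcd P Q \<noteq> 0" by simp
  \<comment> \<open>The gcd is normalised to unit factor 1; since a nonzero scalar of a field is its
    own unit factor, the gcd is monic.\<close>
  have "unit_factor (gcd P Q) = 1" using unit_factor_gcd[of P Q] \<open>P \<noteq> 0\<close> by auto
  then have "Polynomial.coeff (unit_factor (gcd P Q)) 0 = 1" by simp
  then have "unit_factor (lead_coeff (gcd P Q)) = 1"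
    unfolding unit_factor_poly_def by (simp only: coeff_pCons_0)
  moreover have "is_unit (lead_coeff (gcd P Q))" using \<open>gcd P Q \<noteq> 0\<close> by (simp add: dvd_field_iff)
  ultimately have "lead_coeff (gcd P Q) = 1" by (simp add: is_unit_unit_factor)
  then have "lift (gcd P Q) = (\<Prod>i\<in>{i\<in>A. poly (lift (gcd P Q)) (b i) = 0}. [:- b i, 1:])"
    using lift_dvd[of "gcd P Q" P] P A by (intro monic_dvd_prod_linear) (simp_all add: lead_coeff_lift one)
  moreover have "poly (lift (gcd P Q)) (b i) = 0 \<longleftrightarrow> poly (lift Q) (b i) = 0" if "i \<in> A" for i
  proof
    assume "poly (lift (gcd P Q)) (b i) = 0"
    moreover have "lift (gcd P Q) dvd lift Q" by (intro lift_dvd) simp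
    ultimately show "poly (lift Q) (b i) = 0" by (auto elim!: dvdE)
  next
    assume "poly (lift Q) (b i) = 0"
    moreover have "poly (lift P) (b i) = 0" using that A(1) by (auto simp: P poly_prod prod_zero_iff)
    \<comment> \<open>A Bezout identity over the small field survives lifting, so a common root of
      the lifts is a root of the lifted gcd.\<close>
    moreover obtain c d where "gcd P Q = c * P + d * Q"
      using bezout_coefficients_fst_snd[of P Q] by metis
    ultimately show "poly (lift (gcd P Q)) (b i) = 0" by (simp add: lift_add lift_mult)
  qed
  then have "{i\<in>A. poly (lift (gcd P Q)) (b i) = 0} = {i\<in>A. poly (lift Q) (b i) = 0}" by blast
  ultimately show ?thesis by (simp only:)
qed

text \<open>Over the extension both sides are monic divisors of the same split polynomial with the
  same roots; injectivity of \<open>lift\<close> brings the equality back.\<close>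

lemma gcd_eq_monom_minus_1:
  assumes P: "lift (Polynomial.monom 1 n - 1) = (\<Prod>i<n. [:- b i, 1:])"
    and "inj_on b {..<n}" "n > 0" "j dvd n"
    and roots: "\<And>i. i < n \<Longrightarrow> poly (lift Q) (b i) = 0 \<longleftrightarrow> b i ^ j = 1"
  shows "gcd (Polynomial.monom 1 n - 1) Q = Polynomial.monom 1 j - 1"
proof -
  have "j > 0" using assms by (auto intro: Nat.gr0I)
  have "lift (Polynomial.monom 1 j - 1) =
      (\<Prod>i\<in>{i\<in>{..<n}. poly (lift (Polynomial.monom 1 j - 1)) (b i) = 0}. [:- b i, 1:])"
    using lift_dvd[OF monom_minus_1_dvd[OF \<open>j dvd n\<close>]] P assms(2) \<open>j > 0\<close>
    by (intro monic_dvd_prod_linear) (simp_all add: lead_coeff_lift lead_coeff_monom_minus_1(2) one del: coeff_diff)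
  also have "{i\<in>{..<n}. poly (lift (Polynomial.monom 1 j - 1)) (b i) = 0} = {i\<in>{..<n}. poly (lift Q) (b i) = 0}"
    using roots by (auto simp: lift_diff lift_monom lift_1 poly_monom)
  finally have "lift (gcd (Polynomial.monom 1 n - 1) Q) = lift (Polynomial.monom 1 j - 1)"
    using lift_gcd[OF P _ assms(2), of Q] by simp
  then show ?thesis by (simp only: lift_inject)
qed

lemma gcd_eq_1:
  assumes P: "lift (Polynomial.monom 1 n - 1) = (\<Prod>i<n. [:- b i, 1:])"
    and "inj_on b {..<n}" and roots: "\<And>i. i < n \<Longrightarrow> poly (lift Q) (b i) \<noteq> 0"
  shows "gcd (Polynomial.monom 1 n - 1) Q = 1"
proof -
  have "{i\<in>{..<n}. poly (lift Q) (b i) = 0} = {}" using roots by auto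
  then have "lift (gcd (Polynomial.monom 1 n - 1) Q) = lift 1"
    unfolding lift_gcd[OF P finite_lessThan assms(2)] lift_1 by (simp only: prod.empty)
  then show ?thesis by (simp only: lift_inject)
qed

text \<open>The gcd takes the linear factors of \<open>P\<close> at roots of \<open>Q\<close>, and
  the quotient keeps the rest. This serves the case where the answer is described only over the
  extension.\<close>

lemma lift_div_gcd:
  assumes P: "lift P = (\<Prod>i\<in>A. [:- b i, 1:])" and A: "finite A" "inj_on b A"
  shows "lift (P div gcd P Q) = (\<Prod>i\<in>{i\<in>A. poly (lift Q) (b i) \<noteq> 0}. [:- b i, 1:])"
proof -
  let ?f = "\<lambda>i. [:- b i, 1:]"
  let ?Z = "{i\<in>A. poly (lift Q) (b i) = 0}" and ?N = "{i\<in>A. poly (lift Q) (b i) \<noteq> 0}"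
  have "lift (P div gcd P Q) * lift (gcd P Q) = lift P" by (simp flip: lift_mult)
  moreover have "lift P = prod ?f ?N * prod ?f ?Z"
  proof -
    have "A = ?N \<union> ?Z" by auto
    then show ?thesis unfolding P using A(1) by (subst \<open>A = _\<close>, subst prod.union_disjoint) auto
  qed
  moreover have "prod ?f ?Z \<noteq> 0" using A(1) by (auto simp: prod_zero_iff)
  ultimately show ?thesis by (simp add: lift_gcd[OF P A])
qed

end

subsection \<open>Finite fields\<close>

text \<open>Multiplication by \<open>x\<close> permutes the nonzero elements, so it leaves their
  product unchanged.\<close>

lemma finite_field_power_card_minus_1:
  fixes x :: "'a :: {field, finite}"
  assumes "x \<noteq> 0"
  shows "x ^ (card (UNIV :: 'a set) - 1) = 1"
proof -
  have "(\<Prod>y\<in>UNIV - {0}. x * y) = (\<Prod>y\<in>UNIV - {0}. y)"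
    by (rule prod.reindex_bij_witness[of _ "\<lambda>y. y / x" "\<lambda>y. x * y"]) (use assms in auto)
  moreover have "(\<Prod>y\<in>UNIV - {0}. x * y) = x ^ (card (UNIV :: 'a set) - 1) * (\<Prod>y\<in>UNIV - {0}. y)"
    by (simp add: prod.distrib card_Diff_subset)
  moreover have "(\<Prod>y\<in>UNIV - {0 :: 'a}. y) \<noteq> 0" by (simp add: prod_zero_iff)
  ultimately show ?thesis by simp
qed

lemma primitive_element_power_eq_1_iff:
  fixes \<alpha> :: "'a :: {field, finite}"
  assumes prim: "\<forall>x::'a. x \<noteq> 0 \<longrightarrow> (\<exists>i::nat. x = \<alpha> ^ i)" and "\<alpha> \<noteq> 0"
  shows "\<alpha> ^ d = 1 \<longleftrightarrow> card (UNIV :: 'a set) - 1 dvd d"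
proof
  let ?N = "card (UNIV :: 'a set) - 1"
  have N: "\<alpha> ^ ?N = 1" using finite_field_power_card_minus_1 \<open>\<alpha> \<noteq> 0\<close> by blast
  have "card {0, 1 :: 'a} \<le> card (UNIV :: 'a set)" by (rule card_mono) auto
  then have "?N > 0" by simp
  show "\<alpha> ^ d = 1" if "?N dvd d" using that N by (auto simp: power_mult elim!: dvdE)
  assume "\<alpha> ^ d = 1"
  then have r: "\<alpha> ^ (d mod ?N) = 1" using power_cong_exponent[OF N, of "d mod ?N" d] by simp
  show "?N dvd d"
  proof (rule ccontr)
    assume "\<not> ?N dvd d"
    then have pos: "d mod ?N > 0" by (simp add: mod_greater_zero_iff_not_dvd)
    \<comment> \<open>A period shorter than \<open>?N\<close> would leave too few powers of
      \<open>\<alpha>\<close> to cover all \<open>?N\<close> nonzero elements.\<close>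
    have "UNIV - {0} \<subseteq> (\<lambda>i. \<alpha> ^ i) ` {..<d mod ?N}"
    proof
      fix x :: 'a assume "x \<in> UNIV - {0}"
      then obtain i where "x = \<alpha> ^ i" using prim by auto
      then have "x = \<alpha> ^ (i mod (d mod ?N))"
        using power_cong_exponent[OF r, of i "i mod (d mod ?N)"] by simp
      then show "x \<in> (\<lambda>i. \<alpha> ^ i) ` {..<d mod ?N}" using pos by auto
    qed
    then have "card (UNIV - {0 :: 'a}) \<le> card ((\<lambda>i. \<alpha> ^ i) ` {..<d mod ?N})"
      by (intro card_mono) auto
    also have "\<dots> \<le> d mod ?N" using card_image_le[of "{..<d mod ?N}"] by simp
    also have "\<dots> < ?N" using \<open>?N > 0\<close> by simp
    finally show False by (simp add: card_Diff_subset)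
  qed
qed

lemma CHAR_eq_if_card_prime_power:
  assumes "card (UNIV :: 'a :: {field, finite} set) = p ^ k" "prime p"
  shows "CHAR('a) = p"
proof -
  have "prime CHAR('a)" using finite_imp_CHAR_pos[where ?'a = 'a] by (intro prime_CHAR_semidom) auto
  moreover have "CHAR('a) dvd p ^ k" using CHAR_dvd_CARD[where ?'a = 'a] assms(1) by simp
  ultimately show ?thesis using assms(2) prime_dvd_power primes_dvd_imp_eq by blast
qed

lemma inj_on_powers_of_order:
  fixes \<beta> :: "'a :: field"
  assumes "\<And>d. \<beta> ^ d = 1 \<longleftrightarrow> n dvd d" "n > 0"
  shows "inj_on (\<lambda>i. \<beta> ^ i) {..<n}"
proof -
  have "\<beta> \<noteq> 0" using assms(1)[of n] assms(2) by (metis dvd_refl power_0_left neq0_conv zero_neq_one)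
  have "i = j" if "i \<le> j" "j < n" "\<beta> ^ i = \<beta> ^ j" for i j
  proof -
    have "\<beta> ^ i * \<beta> ^ (j - i) = \<beta> ^ i * 1" using that by (metis le_add_diff_inverse mult.right_neutral power_add)
    then have "n dvd j - i" using \<open>\<beta> \<noteq> 0\<close> assms(1) by simp
    then show ?thesis using that by (auto dest: dvd_imp_le)
  qed
  then show ?thesis by (intro inj_onI) (metis lessThan_iff nat_le_linear)
qed

section \<open>Matching the stated definitions, and the case distinction for the generator
  polynomial\<close>

lemma whiteman_D_eq:
  assumes "[int v = u] (mod int (n1 * n2))"
  shows "whiteman_D n1 n2 g u i = (\<lambda>s. g ^ s * v ^ i mod (n1 * n2)) ` {..<(n1 - 1) * (n2 - 1) div 6}"
proof -
  have "nat ((int g ^ s * u ^ i) mod int (n1 * n2)) = g ^ s * v ^ i mod (n1 * n2)" for s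
  proof -
    have "[int g ^ s * int v ^ i = int g ^ s * u ^ i] (mod int (n1 * n2))"
      using assms by (intro cong_mult cong_pow) auto
    then have "(int g ^ s * u ^ i) mod int (n1 * n2) = int (g ^ s * v ^ i mod (n1 * n2))"
      by (simp add: cong_def zmod_int)
    then show ?thesis by simp
  qed
  then show ?thesis by (auto simp: whiteman_D_def)
qed

theorem theorem1:
  fixes n1 n2 g p k :: nat and u :: int
    and \<phi> :: "'a::{field_gcd,finite} \<Rightarrow> 'b::{field,finite}" and \<alpha> :: 'b
  defines "n \<equiv> n1 * n2"
  defines "q \<equiv> p ^ k"
  defines "m \<equiv> ord n q"
  defines "\<beta> \<equiv> \<alpha> ^ ((q ^ m - 1) div n)"
  defines "\<Omega>1 \<equiv> (of_nat ((n1 + 1) div 2) :: 'a)"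
  defines "\<Omega>2 \<equiv> (of_nat ((n2 - 1) div 2) :: 'a)"
  defines "\<Omega> \<equiv> (of_nat (((n1 + 1) * (n2 - 1)) div 2) :: 'a)"
  defines "gs \<equiv> (gen_poly_s n1 n2 g u :: 'a poly)"
  defines "X \<equiv> (\<lambda>j. Polynomial.monom (1::'a) j - 1)"
  assumes n1: "prime n1" "odd n1" and n2: "prime n2" "odd n2" and "n1 \<noteq> n2"
    and gcd6: "gcd (n1 - 1) (n2 - 1) = 6"
    and g: "residue_primroot n1 g" "residue_primroot n2 g"
    and u: "[u = int g] (mod int n1)" "[u = 1] (mod int n2)"
    and p: "prime p" "k > 0" and card_a: "card (UNIV :: 'a set) = q"
    and "coprime q n"
    and qD: "q mod n \<in> whiteman_D n1 n2 g u 1 \<union> whiteman_D n1 n2 g u 3 \<union> whiteman_D n1 n2 g u 5"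
    and card_b: "card (UNIV :: 'b set) = q ^ m"
    and hom: "inj \<phi>" "\<phi> 1 = 1" "\<And>x y. \<phi> (x + y) = \<phi> x + \<phi> y" "\<And>x y. \<phi> (x * y) = \<phi> x * \<phi> y"
    and prim: "\<forall>x::'b. x \<noteq> 0 \<longrightarrow> (\<exists>i::nat. x = \<alpha> ^ i)"
  shows "(\<Omega>1 \<noteq> 0 \<and> \<Omega>2 \<noteq> 0 \<and> \<Omega> \<noteq> 0 \<longrightarrow> gs = X n)
       \<and> (\<Omega>1 \<noteq> 0 \<and> \<Omega>2 \<noteq> 0 \<and> \<Omega> = 0 \<longrightarrow> gs = X n div X 1)
       \<and> (\<Omega>1 = 0 \<and> \<Omega>2 \<noteq> 0 \<and> \<Omega> = 0 \<longrightarrow> gs = X n div X n2)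
       \<and> (\<Omega>1 \<noteq> 0 \<and> \<Omega>2 = 0 \<and> \<Omega> = 0 \<longrightarrow> gs = X n div X n1)
       \<and> (\<Omega>1 = 0 \<and> \<Omega>2 = 0 \<and> \<Omega> = 0 \<longrightarrow>
            map_poly \<phi> gs = (\<Prod>i\<in>units_mod n. [:- (\<beta> ^ i), 1:]))"
proof -
  define v where "v = nat (u mod int n)"
  have pos: "n1 > 0" "n2 > 0" using n1 n2 prime_gt_0_nat by blast+
  then have "n > 0" by (simp add: n_def)
  then have "int v = u mod int n" by (simp add: v_def)
  then have cong_v: "[int v = u] (mod int (n1 * n2))" by (simp add: n_def)
  then have "[int v = u] (mod int n1)" "[int v = u] (mod int n2)"
    by (auto intro: cong_modulus_mult simp: mult.commute[of "int n1"])
  then have "[int v = int g] (mod int n1)" "[int v = int 1] (mod int n2)"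
    using u cong_trans by fastforce+
  then have "[v = g] (mod n1)" "[v = 1] (mod n2)" by (simp_all only: cong_int_iff)
  moreover define e where "e = (n1 - 1) * (n2 - 1) div 6"
  ultimately interpret W: whiteman n1 n2 g v n e
    using n1 n2 \<open>n1 \<noteq> n2\<close> gcd6 g by unfold_locales (auto simp: n_def)
  interpret field_embedding \<phi>
    using hom by unfold_locales auto

  have D: "whiteman_D n1 n2 g u i = W.D i" for i
    unfolding W.D_def unfolding whiteman_D_eq[OF cong_v] n_def e_def ..
  have S: "poly (lift (seqS n1 n2 g u)) z = W.S z" for z
    unfolding seqS_def setC1_def D W.S_def lift_sum poly_sum by (simp add: lift_monom poly_monom)

  have card: "card (UNIV :: 'b set) = p ^ (k * m)" using card_b by (simp add: q_def power_mult)
  then have char: "CHAR('b) = p" using p(1) by (rule CHAR_eq_if_card_prime_power)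

  have "[q ^ m = 1] (mod n)" unfolding m_def by (rule ord)
  then have "n dvd q ^ m - 1" by (rule cong_to_1_nat)
  then obtain c where c: "q ^ m - 1 = n * c" by (elim dvdE)
  have "card {0, 1 :: 'b} \<le> card (UNIV :: 'b set)" by (rule card_mono) auto
  then have "q ^ m - 1 > 0" using card_b by simp
  then have "c > 0" using c by (auto intro: Nat.gr0I)
  have "c = (q ^ m - 1) div n" using c \<open>n > 0\<close> by simp
  \<comment> \<open>As \<open>0 ^ 0 = 1\<close>, the element 0 satisfies \<open>prim\<close> in a
    field with two elements. That field is excluded because \<open>n > 1\<close> divides the
    positive number \<open>q ^ m - 1\<close>.\<close>
  have "\<alpha> \<noteq> 0"
  proof
    assume "\<alpha> = 0"
    then have "x \<in> {0, 1}" for x :: 'b using prim by (metis insert_iff power_0_left)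
    then have "card (UNIV :: 'b set) \<le> card {0, 1 :: 'b}" by (intro card_mono) auto
    then have "q ^ m - 1 \<le> 1" using card_b by simp
    moreover have "n \<le> n * c" using \<open>c > 0\<close> by simp
    ultimately show False using c W.gt1(3) by linarith
  qed
  have ord\<beta>: "\<beta> ^ d = 1 \<longleftrightarrow> n dvd d" for d
  proof -
    have "\<beta> ^ d = \<alpha> ^ (c * d)" unfolding \<beta>_def \<open>c = _\<close> by (simp add: power_mult)
    also have "\<dots> = 1 \<longleftrightarrow> c * n dvd c * d"
      unfolding primitive_element_power_eq_1_iff[OF prim \<open>\<alpha> \<noteq> 0\<close>] card_b c mult.commute[of n] ..
    finally show ?thesis using \<open>c > 0\<close> by simp
  qed
  then have inj\<beta>: "inj_on (\<lambda>i. \<beta> ^ i) {..<n}" using \<open>n > 0\<close> by (rule inj_on_powers_of_order)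
  have "\<beta> ^ n = 1" by (simp add: ord\<beta>)
  then have P: "lift (X n) = (\<Prod>i<n. [:- (\<beta> ^ i), 1:])"
    unfolding X_def lift_diff lift_monom lift_1 using inj\<beta> \<open>n > 0\<close> by (rule monom_minus_1_eq_prod)

  have primitive: "W.S z \<noteq> 0" if z: "z ^ n = 1" "z ^ n1 \<noteq> 1" "z ^ n2 \<noteq> 1" for z :: 'b
  proof
    assume 0: "W.S z = 0"
    have "q mod n \<in> W.D 1 \<union> W.D 3 \<union> W.D 5" using qD by (simp only: D)
    \<comment> \<open>A zero \<open>z\<close> is carried by Frobenius to the zero
      \<open>z ^ (q ^ 3)\<close>, but \<open>q ^ 3\<close> lies in the class \<open>W.D 3\<close>,
      where the two values cannot both vanish.\<close>
    then have "W.S (z ^ (q ^ 3)) \<noteq> 0"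
      using z 0 W.S_primitive_nonzero W.cube_in_D3 by blast
    moreover have "W.S (z ^ (CHAR('b) ^ (k * 3))) = 0"
      using W.S_frobenius[of z "k * 3"] 0 p(1) prime_gt_0_nat[OF p(1)] char by (simp add: power_0_left)
    ultimately show False by (simp add: char q_def power_mult)
  qed
  \<comment> \<open>An embedding preserves natural number constants and their vanishing, so the
    conditions can be tested where S is evaluated.\<close>
  have \<Omega>: "\<Omega>1 = 0 \<longleftrightarrow> (of_nat ((n1 + 1) div 2) :: 'b) = 0"
    "\<Omega>2 = 0 \<longleftrightarrow> (of_nat ((n2 - 1) div 2) :: 'b) = 0"
    "\<Omega> = 0 \<longleftrightarrow> (of_nat ((n1 + 1) * (n2 - 1) div 2) :: 'b) = 0"
    unfolding \<Omega>1_def \<Omega>2_def \<Omega>_def eq_0_iff[symmetric] of_nat by simp_all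
  \<comment> \<open>The zeros of S are sorted by the order of \<open>z\<close>; coprimality of
    \<open>n1\<close> and \<open>n2\<close> keeps the two middle cases apart.\<close>
  have root: "poly (lift (seqS n1 n2 g u)) z = 0 \<longleftrightarrow>
      z = 1 \<and> \<Omega> = 0 \<or> z \<noteq> 1 \<and> z ^ n1 = 1 \<and> \<Omega>2 = 0 \<or> z \<noteq> 1 \<and> z ^ n2 = 1 \<and> \<Omega>1 = 0"
    if "z ^ n = 1" for z
  proof -
    consider "z = 1" | "z \<noteq> 1" "z ^ n1 = 1" | "z \<noteq> 1" "z ^ n2 = 1" | "z ^ n1 \<noteq> 1" "z ^ n2 \<noteq> 1"
      by blast
    then show ?thesis
    proof cases
      case 1
      then show ?thesis using W.S_1[where ?'a = 'b] \<Omega>(3) by (simp add: S)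
    next
      case 2
      then have "z ^ n2 \<noteq> 1" using power_eq_1_coprime W.coprime_n1_n2 by blast
      then show ?thesis using 2 W.S_root_n1[of z] \<Omega>(2) by (simp add: S)
    next
      case 3
      then have "z ^ n1 \<noteq> 1" using power_eq_1_coprime W.coprime_n1_n2 by blast
      then show ?thesis using 3 W.S_root_n2[of z] \<Omega>(1) by (simp add: S)
    next
      case 4
      then show ?thesis using primitive[OF that] by (auto simp: S)
    qed
  qed
  have rootn: "(\<beta> ^ i) ^ n = 1" for i
    using \<open>\<beta> ^ n = 1\<close> by (simp add: power_power_commute[of \<beta> i])
  have gs: "gs = X n div gcd (X n) (seqS n1 n2 g u)"
    by (simp add: gs_def gen_poly_s_def X_def n_def)
  have gcd_X: "gcd (X n) (seqS n1 n2 g u) = X j"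
    if "j dvd n" "\<And>i. i < n \<Longrightarrow> poly (lift (seqS n1 n2 g u)) (\<beta> ^ i) = 0 \<longleftrightarrow> (\<beta> ^ i) ^ j = 1" for j
    using P inj\<beta> \<open>n > 0\<close> that unfolding X_def by (rule gcd_eq_monom_minus_1)

  have "gs = X n" if "\<Omega>1 \<noteq> 0" "\<Omega>2 \<noteq> 0" "\<Omega> \<noteq> 0"
  proof -
    have "gcd (X n) (seqS n1 n2 g u) = 1"
      using P inj\<beta> root[OF rootn] that unfolding X_def by (intro gcd_eq_1) auto
    then show ?thesis by (simp add: gs)
  qed
  moreover have "gs = X n div X 1" if "\<Omega>1 \<noteq> 0" "\<Omega>2 \<noteq> 0" "\<Omega> = 0"
    unfolding gs using root[OF rootn] that by (subst gcd_X[of 1]) auto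
  \<comment> \<open>The zeros are all solutions of \<open>z ^ n2 = 1\<close>: those other than 1
    come from \<open>\<Omega>1 = 0\<close>, and \<open>z = 1\<close> itself from
    \<open>\<Omega> = 0\<close>. The next case is the same with \<open>n1\<close> and
    \<open>\<Omega>2\<close>.\<close>
  moreover have "gs = X n div X n2" if "\<Omega>1 = 0" "\<Omega>2 \<noteq> 0" "\<Omega> = 0"
    unfolding gs using root[OF rootn] that by (subst gcd_X[of n2]) (auto simp: n_def)
  moreover have "gs = X n div X n1" if "\<Omega>1 \<noteq> 0" "\<Omega>2 = 0" "\<Omega> = 0"
    unfolding gs using root[OF rootn] that by (subst gcd_X[of n1]) (auto simp: n_def)
  moreover have "lift gs = (\<Prod>i\<in>units_mod n. [:- (\<beta> ^ i), 1:])" if "\<Omega>1 = 0" "\<Omega>2 = 0" "\<Omega> = 0"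
  proof -
    have "poly (lift (seqS n1 n2 g u)) (\<beta> ^ i) \<noteq> 0 \<longleftrightarrow> coprime i n" for i
    proof -
      \<comment> \<open>Here every nonprimitive root of unity is a zero of S, and
        \<open>\<beta> ^ i\<close> is nonprimitive exactly when \<open>i\<close> shares a prime
        factor with \<open>n\<close>.\<close>
      have "(\<beta> ^ i) ^ n1 = 1 \<longleftrightarrow> n2 dvd i" "(\<beta> ^ i) ^ n2 = 1 \<longleftrightarrow> n1 dvd i"
        using pos by (simp_all add: ord\<beta> n_def mult.commute[of i] flip: power_mult)
      moreover have "coprime i n \<longleftrightarrow> \<not> n1 dvd i \<and> \<not> n2 dvd i"
        using n1(1) n2(1) by (metis coprime_commute coprime_mult_right_iff n_def not_prime_unit
            prime_imp_coprime coprime_common_divisor dvd_refl)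
      ultimately show ?thesis using root[OF rootn[of i]] that by auto
    qed
    then have "{i \<in> {..<n}. poly (lift (seqS n1 n2 g u)) (\<beta> ^ i) \<noteq> 0} = units_mod n"
      by (auto simp: units_mod_def)
    then show ?thesis
      unfolding gs using lift_div_gcd[OF P finite_lessThan inj\<beta>] by simp
  qed
  ultimately show ?thesis by blast
qed

end
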